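(* Let $(X,T)$ be a topological dynamical system which is an extension of an aperiodic topological dynamical system that has a countable number of minimal subsystems. Then $(X,T)$ has the marker property.
   Context: A topological dynamical system (t.d.s) $(X,T)$ is a compact metric space $X$ together with a homeomorphism $T:X\to X$. It is aperiodic if it has no periodic points. $(X,T)$ is an extension of $(Y,S)$ if there is a continuous surjection $\pi:X\to Y$ with $\pi\circ T=S\circ\pi$. A minimal subsystem is a non-empty closed $T$-invariant subset containing no proper non-empty closed $T$-invariant subset. Marker property: a subset $F\subset X$ is an $n$-marker ($n\in\mathbb{N}$) if (1) $F\cap T^{i}(F)=\emptyset$ for $i=1,2,\ldots,n-1$, and (2) there is $m\in\mathbb{N}$ such that the sets $T^{i}(F)$, $1\le i\le m$, cover $X$. The system $(X,T)$ has the marker property if it has an open $n$-marker for every $n\in\mathbb{N}$. *)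

theory Defs
  imports "HOL-Analysis.Analysis"
begin

text \<open>
  A system is given by a compact subset \<open>X\<close> of a metric space type and a self-map \<open>T\<close> of the
  ambient type; only the values of \<open>T\<close> on \<open>X\<close> matter.  Topological notions (open, closed) are
  relative to \<open>X\<close>.
\<close>

definition tds :: "'a::metric_space set \<Rightarrow> ('a \<Rightarrow> 'a) \<Rightarrow> bool" where
  "tds X T \<longleftrightarrow> compact X \<and> (\<exists>T'. homeomorphism X X T T')"

definition aperiodic :: "'a::metric_space set \<Rightarrow> ('a \<Rightarrow> 'a) \<Rightarrow> bool" where
  "aperiodic X T \<longleftrightarrow> \<not> (\<exists>x\<in>X. \<exists>n\<ge>1. (T ^^ n) x = x)"

definition is_extension_of ::
  "'a::metric_space set \<Rightarrow> ('a \<Rightarrow> 'a) \<Rightarrow> 'b::metric_space set \<Rightarrow> ('b \<Rightarrow> 'b) \<Rightarrow> bool" where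
  "is_extension_of X T Y S \<longleftrightarrow>
     (\<exists>\<pi>. continuous_on X \<pi> \<and> \<pi> ` X = Y \<and> (\<forall>x\<in>X. \<pi> (T x) = S (\<pi> x)))"

text \<open>
  Invariance is \<open>T ` M = M\<close>, so that the restriction of \<open>T\<close> to \<open>M\<close> is again a homeomorphism.
\<close>

definition subsystem :: "'a::metric_space set \<Rightarrow> ('a \<Rightarrow> 'a) \<Rightarrow> 'a set \<Rightarrow> bool" where
  "subsystem X T M \<longleftrightarrow> M \<noteq> {} \<and> closedin (top_of_set X) M \<and> T ` M = M"

definition minimal_subsystem :: "'a::metric_space set \<Rightarrow> ('a \<Rightarrow> 'a) \<Rightarrow> 'a set \<Rightarrow> bool" where
  "minimal_subsystem X T M \<longleftrightarrow> subsystem X T M \<and> \<not> (\<exists>N. N \<subset> M \<and> subsystem X T N)"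

text \<open>
  For \<open>n = 0\<close> the disjointness condition is vacuous, as it is for \<open>n = 1\<close>, so it makes no
  difference whether \<open>0\<close> counts as a natural number here.
\<close>

definition marker :: "'a::metric_space set \<Rightarrow> ('a \<Rightarrow> 'a) \<Rightarrow> nat \<Rightarrow> 'a set \<Rightarrow> bool" where
  "marker X T n F \<longleftrightarrow> F \<subseteq> X \<and>
     (\<forall>i\<in>{1..<n}. F \<inter> (T ^^ i) ` F = {}) \<and>
     (\<exists>m. X \<subseteq> (\<Union>i\<in>{1..m}. (T ^^ i) ` F))"

definition marker_property :: "'a::metric_space set \<Rightarrow> ('a \<Rightarrow> 'a) \<Rightarrow> bool" where
  "marker_property X T \<longleftrightarrow> (\<forall>n. \<exists>F. openin (top_of_set X) F \<and> marker X T n F)"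

end

theory Submission
  imports Defs
begin

text \<open>
  An open set meeting every minimal subsystem of \<open>Y\<close> has finitely many images covering
  \<open>Y\<close>, so it suffices to find such a set disjoint from its first \<open>n - 1\<close> images; it then
  pulls back to \<open>X\<close>. Picking a point in each minimal subsystem gives a countable invariant set
  \<open>D\<close>. Each point of \<open>Y\<close> has small balls disjoint from their first \<open>n - 1\<close> images, and all but
  countably many radii give spheres missing \<open>D\<close>. Adding such balls one at a time, each time
  removing the translates of the closure of the set obtained so far, yields a set that meets the
  orbit of every point of \<open>D\<close>.
\<close>

section \<open>Open sets disjoint from finitely many translates\<close>

text \<open>Each \<open>g\<close> moves \<open>y\<close>, so by continuity it carries every
  sufficiently small ball about \<open>y\<close> off itself; as \<open>G\<close> is finite, one
  bound on the radius serves all \<open>g\<close>. Below that bound only the countably many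
  distances from \<open>y\<close> to points of \<open>D\<close> are excluded.\<close>

lemma separated_ball:
  fixes Y :: "'a::metric_space set"
  assumes "finite G" and cont: "\<And>g. g \<in> G \<Longrightarrow> continuous_on Y g"
    and free: "\<And>g. g \<in> G \<Longrightarrow> g y \<noteq> y"
    and "countable D" and "y \<in> Y"
  obtains r where "r > 0" "\<And>x g. x \<in> Y \<inter> ball y r \<Longrightarrow> g \<in> G \<Longrightarrow> g x \<notin> ball y r"
    "D \<inter> sphere y r = {}"
proof -
  have "\<forall>\<^sub>F r in at_right 0. \<forall>x\<in>Y \<inter> ball y r. g x \<notin> ball y r" if "g \<in> G" for g
  proof -
    \<comment> \<open>Half the displacement of \<open>y\<close>: if \<open>g x\<close> were within
      \<open>e\<close> of both \<open>y\<close> and \<open>g y\<close>, the triangle inequality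
      would give \<open>dist (g y) y < 2 * e\<close>.\<close>
    define e where "e = dist (g y) y / 2"
    have "e > 0" using free[OF that] by (simp add: e_def)
    with cont[OF that] \<open>y \<in> Y\<close> obtain d
      where d: "d > 0" "\<And>x. x \<in> Y \<Longrightarrow> dist x y < d \<Longrightarrow> dist (g x) (g y) < e"
      unfolding continuous_on_iff by metis
    have "g x \<notin> ball y r" if "r < min d e" "x \<in> Y \<inter> ball y r" for x r
    proof
      assume "g x \<in> ball y r"
      then have "dist y (g x) < e" using that by simp
      moreover have "dist (g x) (g y) < e" using that d(2)[of x] by (simp add: dist_commute)
      ultimately show False
        using dist_triangle[of "g y" y "g x"] by (simp add: e_def dist_commute)
    qed
    moreover have "\<forall>\<^sub>F r in at_right 0. r < min d e"
      using \<open>d > 0\<close> \<open>e > 0\<close> by (intro eventually_at_right_real[THEN eventually_mono, of 0 "min d e"]) auto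
    ultimately show ?thesis by (auto elim!: eventually_mono)
  qed
  then have "\<forall>\<^sub>F r in at_right 0. \<forall>g\<in>G. \<forall>x\<in>Y \<inter> ball y r. g x \<notin> ball y r"
    using \<open>finite G\<close> by (simp add: eventually_ball_finite)
  then obtain b :: real where b: "b > 0"
    "\<And>r. 0 < r \<Longrightarrow> r < b \<Longrightarrow> \<forall>g\<in>G. \<forall>x\<in>Y \<inter> ball y r. g x \<notin> ball y r"
    unfolding eventually_at_right_field by auto
  have "uncountable ({0<..<b} - dist y ` D)"
    using b(1) \<open>countable D\<close> by (intro uncountable_minus_countable) (auto simp: uncountable_open_interval)
  then obtain r where "r \<in> {0<..<b}" "r \<notin> dist y ` D"
    using countable_empty by (metis DiffE all_not_in_conv)
  then show thesis using b(2)[of r] by (intro that[of r]) auto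
qed

text \<open>
  The set is built greedily along a finite cover by balls. As the spheres miss \<open>D\<close>, a point of
  \<open>D\<close> in the closure of the set constructed so far lies in the set itself.
\<close>
lemma open_separated_set:
  fixes Y :: "'a::metric_space set"
  assumes "compact Y" and "finite G"
    and cont: "\<And>g. g \<in> G \<Longrightarrow> continuous_on Y g"
    and maps: "\<And>g. g \<in> G \<Longrightarrow> g ` Y \<subseteq> Y"
    and free: "\<And>g y. g \<in> G \<Longrightarrow> y \<in> Y \<Longrightarrow> g y \<noteq> y"
    and sym: "\<And>g. g \<in> G \<Longrightarrow> \<exists>h\<in>G. \<forall>y\<in>Y. h (g y) = y"
    and "countable D" "D \<subseteq> Y" and invD: "\<And>g. g \<in> G \<Longrightarrow> g ` D \<subseteq> D"
  obtains W where "openin (top_of_set Y) W" "\<And>x g. x \<in> W \<Longrightarrow> g \<in> G \<Longrightarrow> g x \<notin> W"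
    "\<And>d. d \<in> D \<Longrightarrow> d \<in> W \<or> (\<exists>g\<in>G. g d \<in> W)"
proof -
  have "\<exists>r>0. (\<forall>x\<in>Y \<inter> ball y r. \<forall>g\<in>G. g x \<notin> ball y r) \<and> D \<inter> sphere y r = {}"
    if "y \<in> Y" for y
    using separated_ball[of G Y y D] assms that by metis
  then obtain r where r: "\<And>y. y \<in> Y \<Longrightarrow> r y > 0"
    "\<And>y x g. y \<in> Y \<Longrightarrow> x \<in> Y \<inter> ball y (r y) \<Longrightarrow> g \<in> G \<Longrightarrow> g x \<notin> ball y (r y)"
    "\<And>y. y \<in> Y \<Longrightarrow> D \<inter> sphere y (r y) = {}"
    by metis
  \<comment> \<open>The clause on \<open>closure W\<close> is what keeps the induction going:
    closures have to be removed to keep the next piece open, and on \<open>D\<close> this removes no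
    more than \<open>W\<close> and its translates would.\<close>
  have step: "\<exists>W. openin (top_of_set Y) W \<and> (\<forall>x\<in>W. \<forall>g\<in>G. g x \<notin> W) \<and> D \<inter> closure W \<subseteq> W \<and>
      (\<forall>d\<in>D \<inter> (\<Union>y\<in>F. ball y (r y)). d \<in> W \<or> (\<exists>g\<in>G. g d \<in> W))"
    if "finite F" "F \<subseteq> Y" for F
    using that
  proof (induction F)
    case empty
    then show ?case by (intro exI[of _ "{}"]) auto
  next
    case (insert y F)
    then obtain W where W: "openin (top_of_set Y) W" "\<And>x g. x \<in> W \<Longrightarrow> g \<in> G \<Longrightarrow> g x \<notin> W"
      "D \<inter> closure W \<subseteq> W"
      "\<And>d. d \<in> D \<Longrightarrow> d \<in> (\<Union>y\<in>F. ball y (r y)) \<Longrightarrow> d \<in> W \<or> (\<exists>g\<in>G. g d \<in> W)"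
      by auto
    have "y \<in> Y" using insert by simp
    have "W \<subseteq> Y" using W(1) by (auto dest: openin_imp_subset)
    \<comment> \<open>\<open>B\<close> is closed because \<open>G\<close> is finite, so
      \<open>V\<close> is open in \<open>Y\<close>; \<open>id\<close> accounts for \<open>W\<close>
      itself. \<open>N\<close> is the relatively open analogue with \<open>W\<close> in place of its
      closure: it lies in \<open>B\<close>, and the two agree on \<open>D\<close>.\<close>
    define B where "B = (\<Union>g\<in>insert id G. Y \<inter> g -` closure W)"
    define V where "V = Y \<inter> ball y (r y) - B"
    define N where "N = (\<Union>g\<in>insert id G. Y \<inter> g -` W)"
    have "closed (Y \<inter> g -` closure W)" if "g \<in> insert id G" for g
      using that cont compact_imp_closed[OF \<open>compact Y\<close>]
      by (intro continuous_closed_preimage) auto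
    then have "closed B" unfolding B_def using \<open>finite G\<close> by (intro closed_UN) auto
    then have openV: "openin (top_of_set Y) V"
      by (auto simp: V_def openin_open intro!: exI[of _ "ball y (r y) - B"])
    have "openin (top_of_set Y) (Y \<inter> g -` W)" if "g \<in> insert id G" for g
      using that cont maps W(1) by (intro continuous_openin_preimage[where T = Y]) auto
    then have openN: "openin (top_of_set Y) N" unfolding N_def by blast
    have disj: "N \<inter> V = {}" using closure_subset[of W] by (auto simp: N_def V_def B_def)
    \<comment> \<open>A limit point of \<open>V\<close> in \<open>D\<close> is off the sphere, hence
      in the open ball. It is not in \<open>N\<close>, which is open in \<open>Y\<close> and misses
      \<open>V\<close>, hence not in \<open>B\<close> either.\<close>
    have "D \<inter> closure V \<subseteq> V"
    proof
      fix d assume d: "d \<in> D \<inter> closure V"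
      have "closure V \<subseteq> cball y (r y)"
        by (intro closure_minimal) (auto simp: V_def)
      then have dball: "d \<in> ball y (r y)" using d r(3)[OF \<open>y \<in> Y\<close>] by force
      have "d \<notin> N"
      proof
        assume "d \<in> N"
        from openN obtain O' where "open O'" "N = Y \<inter> O'" unfolding openin_open by auto
        with \<open>d \<in> N\<close> d have "O' \<inter> V \<noteq> {}" using open_Int_closure_eq_empty[of O' V] by auto
        then show False using disj \<open>N = Y \<inter> O'\<close> by (auto simp: V_def)
      qed
      moreover have "d \<in> N" if "d \<in> B"
        using that d invD W(3) \<open>D \<subseteq> Y\<close> unfolding B_def N_def by fastforce
      ultimately show "d \<in> V" using d dball \<open>D \<subseteq> Y\<close> by (auto simp: V_def)
    qed
    then have "D \<inter> closure (W \<union> V) \<subseteq> W \<union> V" using W(3) by auto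
    moreover have "g x \<notin> W \<union> V" if x: "x \<in> W \<union> V" and g: "g \<in> G" for x g
    proof
      assume gx: "g x \<in> W \<union> V"
      \<comment> \<open>The inverse \<open>h\<close> handles a point of \<open>W\<close> sent into
        \<open>V\<close>: \<open>h\<close> brings the image back to \<open>W\<close>, which puts
        that image in \<open>N\<close>.\<close>
      obtain h where h: "h \<in> G" "\<forall>y\<in>Y. h (g y) = y" using sym[OF g] by auto
      have "x \<in> Y" using x \<open>W \<subseteq> Y\<close> by (auto simp: V_def)
      consider "x \<in> W" "g x \<in> W" | "x \<in> W" "g x \<in> V" | "x \<in> V" "g x \<in> W" | "x \<in> V" "g x \<in> V"
        using x gx by auto
      then show False
      proof cases
        case 1 then show False using W(2) g by auto
      next
        case 2
        then have "h (g x) \<in> W" "g x \<in> Y" using h \<open>x \<in> Y\<close> by (auto simp: V_def)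
        then have "g x \<in> N" using h(1) by (auto simp: N_def)
        then show False using 2 disj by auto
      next
        case 3
        then have "x \<in> N" using g \<open>x \<in> Y\<close> by (auto simp: N_def)
        then show False using 3 disj by auto
      next
        case 4 then show False using r(2)[OF \<open>y \<in> Y\<close> _ g, of x] by (auto simp: V_def)
      qed
    qed
    moreover have "d \<in> W \<union> V \<or> (\<exists>g\<in>G. g d \<in> W \<union> V)"
      if d: "d \<in> D" "d \<in> (\<Union>y\<in>insert y F. ball y (r y))" for d
    proof (cases "d \<in> (\<Union>y\<in>F. ball y (r y))")
      case True then show ?thesis using W(4)[OF d(1)] by auto
    next
      case False
      then have "d \<in> Y \<inter> ball y (r y)" using d \<open>D \<subseteq> Y\<close> by auto
      then have "d \<in> V \<or> d \<in> B" by (auto simp: V_def)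
      \<comment> \<open>A point of \<open>D\<close> lost to \<open>B\<close> already has itself or a
        translate in \<open>closure W\<close>; that point is in \<open>D\<close>, hence in
        \<open>W\<close>.\<close>
      moreover have "d \<in> W \<or> (\<exists>g\<in>G. g d \<in> W)" if "d \<in> B"
        using that d(1) invD W(3) unfolding B_def by fastforce
      ultimately show ?thesis by auto
    qed
    ultimately show ?case using W(1) openV
      by (intro exI[of _ "W \<union> V"]) (auto intro: openin_Un)
  qed
  have "Y \<subseteq> (\<Union>y\<in>Y. ball y (r y))" using r(1) by auto
  then obtain F where "F \<subseteq> Y" "finite F" "Y \<subseteq> (\<Union>y\<in>F. ball y (r y))"
    using compactE_image[OF \<open>compact Y\<close>, of Y "\<lambda>y. ball y (r y)"] by auto
  then obtain W where W: "openin (top_of_set Y) W" "\<forall>x\<in>W. \<forall>g\<in>G. g x \<notin> W"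
    "\<forall>d\<in>D \<inter> (\<Union>y\<in>F. ball y (r y)). d \<in> W \<or> (\<exists>g\<in>G. g d \<in> W)"
    using step[of F] by auto
  moreover have "D \<subseteq> D \<inter> (\<Union>y\<in>F. ball y (r y))"
    using \<open>D \<subseteq> Y\<close> \<open>Y \<subseteq> (\<Union>y\<in>F. ball y (r y))\<close> by blast
  ultimately show thesis using that[of W] by blast
qed

section \<open>Minimal subsystems and covers by iterates\<close>

text \<open>Zorn's lemma for non-empty closed forward-invariant subsets of \<open>K\<close>, with
  compactness keeping intersections of chains non-empty.\<close>

lemma minimal_subsystem_exists:
  fixes Y :: "'a::metric_space set"
  assumes "compact Y" and cont: "continuous_on Y S"
    and K: "closed K" "K \<noteq> {}" "K \<subseteq> Y" "S ` K \<subseteq> K"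
  obtains M where "minimal_subsystem Y S M" "M \<subseteq> K"
proof -
  \<comment> \<open>Complements reverse inclusion, so a maximal element of \<open>A\<close> is the
    complement of a minimal set.\<close>
  define A where "A = {V. closed (- V) \<and> - V \<noteq> {} \<and> - V \<subseteq> K \<and> S ` (- V) \<subseteq> - V}"
  have cpt: "compact L" if "closed L" "L \<subseteq> K" for L
    using that K(3) \<open>compact Y\<close> closed_Int_compact[of L Y] by (simp add: Int_absorb2)
  have "\<exists>V\<in>A. \<forall>V'\<in>A. V \<subseteq> V' \<longrightarrow> V' = V"
  proof (rule subset_Zorn_nonempty)
    show "A \<noteq> {}" using K by (auto simp: A_def intro!: exI[of _ "- K"])
  next
    fix C assume C: "C \<noteq> {}" "subset.chain A C"
    then have CA: "C \<subseteq> A" by (auto simp: subset.chain_def)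
    have op: "open V" and ne: "- V \<noteq> {}" and sub: "- V \<subseteq> K" and inv: "S ` (- V) \<subseteq> - V"
      if "V \<in> C" for V
      using that CA by (auto simp: A_def open_closed)
    \<comment> \<open>Otherwise finitely many members of \<open>C\<close> cover \<open>K\<close>; in
      a chain their union is one of them, whose complement is then empty.\<close>
    have "- \<Union> C \<noteq> {}"
    proof
      assume "- \<Union> C = {}"
      then have "K \<subseteq> \<Union> C" by auto
      then obtain F where F: "F \<subseteq> C" "finite F" "K \<subseteq> \<Union> F"
        using compactE[of K C] cpt[of K] K(1) op by blast
      then have "F \<noteq> {}" using K(2) by auto
      moreover have "subset.chain A F" using F(1) C(2) unfolding subset.chain_def by blast
      ultimately have "\<Union> F \<in> C" using F Union_in_chain by blast
      then show False using ne[of "\<Union> F"] sub[of "\<Union> F"] F(3) by auto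
    qed
    moreover have "- \<Union> C \<subseteq> K" using sub C(1) by blast
    moreover have "S ` (- \<Union> C) \<subseteq> - \<Union> C" using inv by blast
    ultimately show "\<Union> C \<in> A" using op by (simp add: A_def open_Union flip: open_closed)
  qed
  then obtain V where V: "V \<in> A" "\<And>V'. V' \<in> A \<Longrightarrow> V \<subseteq> V' \<Longrightarrow> V' = V" by auto
  define M where "M = - V"
  have M: "closed M" "M \<noteq> {}" "M \<subseteq> K" "S ` M \<subseteq> M" using V(1) by (auto simp: A_def M_def)
  have least: "L = M" if "closed L" "L \<noteq> {}" "L \<subseteq> M" "S ` L \<subseteq> L" for L
    using that V(2)[of "- L"] M(3) by (auto simp: A_def M_def)
  have "continuous_on M S" using cont M(3) K(3) by (meson continuous_on_subset order_trans)
  then have "compact (S ` M)" using M by (intro compact_continuous_image cpt)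
  then have "S ` M = M" using M by (intro least compact_imp_closed) auto
  moreover have "closed N" if "closedin (top_of_set Y) N" for N
    using that compact_imp_closed[OF \<open>compact Y\<close>] by (auto intro: closedin_closed_trans)
  moreover have "closedin (top_of_set Y) M" using M K(3) by (intro closed_subset) auto
  moreover have False if "N \<subset> M" "subsystem Y S N" for N
    using that least[of N] calculation(2)[of N] by (auto simp: subsystem_def)
  ultimately have "minimal_subsystem Y S M"
    using M(2) unfolding minimal_subsystem_def subsystem_def by blast
  then show thesis using M(3) that by auto
qed

lemma funpow_in: "f ` A \<subseteq> A \<Longrightarrow> x \<in> A \<Longrightarrow> (f ^^ i) x \<in> A"
  by (induction i) auto

lemma homeomorphism_funpow:
  "homeomorphism A A f g \<Longrightarrow> homeomorphism A A (f ^^ i) (g ^^ i)"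
proof (induction i)
  case 0
  then show ?case by (auto simp: homeomorphism_def continuous_on_id)
next
  case (Suc i)
  have "homeomorphism A A (f \<circ> f ^^ i) (g ^^ i \<circ> g)"
    using homeomorphism_compose Suc by blast
  then show ?case by (metis funpow.simps(2) funpow_Suc_right)
qed

text \<open>The points whose forward orbit avoids \<open>W\<close> form a closed forward-invariant
  set; were it non-empty, it would contain a minimal subsystem missing \<open>W\<close>. So
  preimages of \<open>W\<close> cover \<open>Y\<close>, finitely many suffice, and invertibility
  turns them into images.\<close>

lemma marker_if_meets_minimal:
  fixes Y :: "'a::metric_space set"
  assumes Y: "tds Y S" and W: "openin (top_of_set Y) W"
    and disj: "\<And>i. i \<in> {1..<n} \<Longrightarrow> W \<inter> (S ^^ i) ` W = {}"
    and meets: "\<And>M. minimal_subsystem Y S M \<Longrightarrow> M \<inter> W \<noteq> {}"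
  shows "marker Y S n W"
proof -
  obtain S' where hom: "homeomorphism Y Y S S'" and "compact Y" using Y by (auto simp: tds_def)
  note homi = homeomorphism_funpow[OF hom]
  have "W \<subseteq> Y" using W by (auto dest: openin_imp_subset)
  define P where "P i = Y \<inter> (S ^^ i) -` W" for i
  have openP: "openin (top_of_set Y) (P i)" for i
    using homi[of i] W unfolding P_def homeomorphism_def
    by (intro continuous_openin_preimage[where T = Y]) auto
  define K where "K = Y - (\<Union>i. P i)"
  have "openin (top_of_set Y) (\<Union>i. P i)" using openP by blast
  then have "closedin (top_of_set Y) K" unfolding K_def using closedin_diff closedin_topspace by fastforce
  then have "closed K"
    using compact_imp_closed[OF \<open>compact Y\<close>] closedin_closed_trans by blast
  moreover have "S ` K \<subseteq> K"
  proof
    fix z assume "z \<in> S ` K"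
    then obtain y where y: "y \<in> K" "z = S y" by auto
    then have "z \<in> Y" using hom by (auto simp: K_def homeomorphism_def)
    moreover have "z \<notin> P i" for i
    proof -
      have "y \<notin> P (Suc i)" "y \<in> Y" using y(1) by (auto simp: K_def)
      then show ?thesis using y(2) by (simp add: P_def funpow_Suc_right del: funpow.simps)
    qed
    ultimately show "z \<in> K" by (auto simp: K_def)
  qed
  moreover have "\<not> (minimal_subsystem Y S M \<and> M \<subseteq> K)" for M
  proof -
    have "W \<subseteq> P 0" using \<open>W \<subseteq> Y\<close> by (auto simp: P_def)
    then have "K \<inter> W = {}" by (auto simp: K_def)
    then show ?thesis using meets[of M] by auto
  qed
  moreover have "continuous_on Y S" "K \<subseteq> Y" using hom by (auto simp: homeomorphism_def K_def)
  ultimately have "K = {}"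
    using minimal_subsystem_exists[OF \<open>compact Y\<close>, of S K] by metis
  then have "Y \<subseteq> (\<Union>i. P i)" by (auto simp: K_def)
  then obtain Q where "Q \<subseteq> range P" "finite Q" "Y \<subseteq> \<Union> Q"
    using \<open>compact Y\<close> openP unfolding compact_eq_openin_cover by (metis imageE)
  then obtain I where I: "finite I" "Y \<subseteq> (\<Union>i\<in>I. P i)"
    by (metis finite_subset_image)
  \<comment> \<open>\<open>m\<close> exceeds every index in \<open>I\<close>, so writing
    \<open>y\<close> as the \<open>m\<close>-th iterate of \<open>z\<close> leaves an exponent
    \<open>m - i\<close> of at least 1. Inserting 0 makes \<open>Max\<close> meaningful for empty
    \<open>I\<close>.\<close>
  define m where "m = Suc (Max (insert 0 I))"
  have "Y \<subseteq> (\<Union>i\<in>{1..m}. (S ^^ i) ` W)"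
  proof
    fix y assume "y \<in> Y"
    then obtain z where z: "z \<in> Y" "(S ^^ m) z = y"
      using homi[of m] unfolding homeomorphism_def by (metis imageE)
    then obtain i where i: "i \<in> I" "(S ^^ i) z \<in> W" using I by (auto simp: P_def)
    then have "i < m" using I(1) by (simp add: m_def less_Suc_eq_le)
    then have "y = (S ^^ (m - i)) ((S ^^ i) z)"
      using z by (simp flip: funpow_add comp_apply[of "S ^^ (m - i)"])
    then show "y \<in> (\<Union>i\<in>{1..m}. (S ^^ i) ` W)"
      using i \<open>i < m\<close> by (intro UN_I[of "m - i"]) auto
  qed
  then show ?thesis using \<open>W \<subseteq> Y\<close> disj unfolding marker_def by blast
qed

section \<open>Markers from countably many minimal subsystems\<close>

lemma countably_many_minimal_imp_marker_property:
  fixes Y :: "'a::metric_space set"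
  assumes Y: "tds Y S" and ap: "aperiodic Y S"
    and count: "countable {M. minimal_subsystem Y S M}"
  shows "marker_property Y S"
  unfolding marker_property_def
proof
  fix n
  obtain S' where hom: "homeomorphism Y Y S S'" and "compact Y" using Y by (auto simp: tds_def)
  note homi = homeomorphism_funpow[OF hom]
  have inv: "(S' ^^ i) ((S ^^ i) y) = y" "(S ^^ i) ((S' ^^ i) y) = y"
    and maps: "(S ^^ i) y \<in> Y" "(S' ^^ i) y \<in> Y" if "y \<in> Y" for i y
    using homi[of i] that by (auto simp: homeomorphism_def)
  \<comment> \<open>Backward powers are included so that every map in \<open>G\<close> has its
    inverse on \<open>Y\<close> in \<open>G\<close>.\<close>
  define G where "G = (\<lambda>i. S ^^ i) ` {1..<n} \<union> (\<lambda>i. S' ^^ i) ` {1..<n}"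
  define p where "p M = (SOME y. y \<in> M)" for M :: "'a set"
  define C where "C = p ` {M. minimal_subsystem Y S M}"
  have pM: "p M \<in> M" and MY: "M \<subseteq> Y" if "minimal_subsystem Y S M" for M
    using that by (auto simp: minimal_subsystem_def subsystem_def p_def some_in_eq
        dest: closedin_imp_subset)
  \<comment> \<open>The union of the full two-sided orbits of the chosen points, expressed through
    forward powers only.\<close>
  define D where "D = {y \<in> Y. \<exists>a b. (S ^^ a) y \<in> (S ^^ b) ` C}"
  have "C \<subseteq> D" using pM MY by (force simp: C_def D_def intro: exI[of _ 0])
  have "countable {y \<in> Y. (S ^^ a) y \<in> (\<Union>b. (S ^^ b) ` C)}" for a
  proof (rule countable_image_inj_on)
    show "inj_on (S ^^ a) {y \<in> Y. (S ^^ a) y \<in> (\<Union>b. (S ^^ b) ` C)}"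
      by (rule inj_on_inverseI[where g = "S' ^^ a"]) (auto simp: inv)
    show "countable ((S ^^ a) ` {y \<in> Y. (S ^^ a) y \<in> (\<Union>b. (S ^^ b) ` C)})"
      by (rule countable_subset[of _ "\<Union>b. (S ^^ b) ` C"]) (auto simp: C_def count)
  qed
  then have "countable (\<Union>a. {y \<in> Y. (S ^^ a) y \<in> (\<Union>b. (S ^^ b) ` C)})" by blast
  moreover have "D = (\<Union>a. {y \<in> Y. (S ^^ a) y \<in> (\<Union>b. (S ^^ b) ` C)})" by (auto simp: D_def)
  ultimately have "countable D" by simp
  have invD: "(S ^^ i) y \<in> D" "(S' ^^ i) y \<in> D" if "y \<in> D" for i y
  proof -
    from that obtain a b c where abc: "y \<in> Y" "c \<in> C" "(S ^^ a) y = (S ^^ b) c" by (auto simp: D_def)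
    have "(S ^^ a) ((S ^^ i) y) = (S ^^ (i + b)) c"
    proof -
      have "(S ^^ a) ((S ^^ i) y) = (S ^^ i) ((S ^^ a) y)"
        by (simp add: add.commute flip: funpow_add comp_apply[of "S ^^ _" "S ^^ _"])
      then show ?thesis using abc(3) by (simp add: funpow_add)
    qed
    then show "(S ^^ i) y \<in> D" using abc maps by (auto simp: D_def)
    have "(S ^^ (a + i)) ((S' ^^ i) y) = (S ^^ b) c" using abc by (simp add: funpow_add inv)
    then show "(S' ^^ i) y \<in> D" using abc maps by (auto simp: D_def)
  qed
  \<comment> \<open>A fixed point of a power of \<open>S'\<close> is fixed by the same power of
    \<open>S\<close>, so aperiodicity covers both directions.\<close>
  have free: "(S ^^ i) y \<noteq> y" "(S' ^^ i) y \<noteq> y" if "y \<in> Y" "i \<in> {1..<n}" for i y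
    using that ap inv[of y i] by (auto simp: aperiodic_def)
  obtain W where W: "openin (top_of_set Y) W" "\<And>x g. x \<in> W \<Longrightarrow> g \<in> G \<Longrightarrow> g x \<notin> W"
    "\<And>d. d \<in> D \<Longrightarrow> d \<in> W \<or> (\<exists>g\<in>G. g d \<in> W)"
  proof (rule open_separated_set[OF \<open>compact Y\<close>, of G D])
    show "finite G" by (simp add: G_def)
    show "continuous_on Y g" if "g \<in> G" for g
      using that homi by (auto simp: G_def homeomorphism_def)
    show "g ` Y \<subseteq> Y" if "g \<in> G" for g
      using that maps by (auto simp: G_def)
    show "g y \<noteq> y" if "g \<in> G" "y \<in> Y" for g y
      using that free by (auto simp: G_def)
    show "\<exists>h\<in>G. \<forall>y\<in>Y. h (g y) = y" if "g \<in> G" for g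
      using that inv unfolding G_def by blast
    show "g ` D \<subseteq> D" if "g \<in> G" for g
      using that invD by (auto simp: G_def)
  qed (use \<open>countable D\<close> in \<open>auto simp: D_def\<close>)
  have "M \<inter> W \<noteq> {}" if M: "minimal_subsystem Y S M" for M
  proof -
    have SM: "S ` M = M" using M by (simp add: minimal_subsystem_def subsystem_def)
    \<comment> \<open>\<open>M\<close> is preserved by \<open>S\<close> and \<open>S'\<close>, so
      whichever translate of \<open>p M\<close> lands in \<open>W\<close> still lies in
      \<open>M\<close>.\<close>
    have "S' z \<in> M" if "z \<in> M" for z
    proof -
      have "z \<in> S ` M" using SM that by simp
      then obtain w where "w \<in> M" "z = S w" by auto
      then show ?thesis using MY[OF M] hom homeomorphism_apply1 by fastforce
    qed
    then have "S' ` M \<subseteq> M" by blast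
    then have "g (p M) \<in> M" if "g \<in> G" for g
      using that pM[OF M] funpow_in[of S M] funpow_in[of S' M] equalityD1[OF SM]
      by (auto simp only: G_def)
    moreover have "p M \<in> D" using \<open>C \<subseteq> D\<close> M by (auto simp: C_def)
    ultimately show ?thesis using W(3)[of "p M"] pM[OF M] by auto
  qed
  moreover have "W \<inter> (S ^^ i) ` W = {}" if "i \<in> {1..<n}" for i
    using W(2)[of _ "S ^^ i"] that by (auto simp: G_def)
  ultimately have "marker Y S n W" using Y W(1) marker_if_meets_minimal by blast
  then show "\<exists>F. openin (top_of_set Y) F \<and> marker Y S n F" using W(1) by blast
qed

section \<open>Lifting markers to extensions\<close>

text \<open>The preimage of a marker under the factor map is a marker with the same \<open>n\<close>
  and \<open>m\<close>: equivariance transports a common point down and the cover up.\<close>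

lemma marker_property_extension:
  assumes X: "tds X T" and Y: "tds Y S" and ext: "is_extension_of X T Y S"
    and mp: "marker_property Y S"
  shows "marker_property X T"
  unfolding marker_property_def
proof
  fix n
  obtain F m where F: "openin (top_of_set Y) F" "F \<subseteq> Y" "\<And>i. i \<in> {1..<n} \<Longrightarrow> F \<inter> (S ^^ i) ` F = {}"
    "Y \<subseteq> (\<Union>i\<in>{1..m}. (S ^^ i) ` F)"
    using mp unfolding marker_property_def marker_def by metis
  obtain \<pi> where \<pi>: "continuous_on X \<pi>" "\<pi> ` X = Y" "\<And>x. x \<in> X \<Longrightarrow> \<pi> (T x) = S (\<pi> x)"
    using ext unfolding is_extension_of_def by auto
  obtain T' where "homeomorphism X X T T'" using X by (auto simp: tds_def)
  then have T: "(T ^^ i) ` X = X" for i using homeomorphism_funpow homeomorphism_def by metis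
  obtain S' where "homeomorphism Y Y S S'" using Y by (auto simp: tds_def)
  then have S: "inj_on (S ^^ i) Y" for i
    using homeomorphism_funpow[of Y S S' i] by (auto simp: homeomorphism_def intro: inj_on_inverseI)
  have \<pi>T: "\<pi> ((T ^^ i) x) = (S ^^ i) (\<pi> x)" if "x \<in> X" for i x
  proof (induction i)
    case (Suc i)
    have "(T ^^ i) x \<in> X" using T[of i] that by blast
    then show ?case using Suc by (simp add: \<pi>(3))
  qed simp
  define E where "E = X \<inter> \<pi> -` F"
  have "openin (top_of_set X) E"
    using \<pi> F(1) unfolding E_def by (intro continuous_openin_preimage[where T = Y]) auto
  moreover have "E \<inter> (T ^^ i) ` E = {}" if "i \<in> {1..<n}" for i
    using F(3)[OF that] \<pi>T by (auto simp: E_def)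
  moreover have "X \<subseteq> (\<Union>i\<in>{1..m}. (T ^^ i) ` E)"
  proof
    fix x assume "x \<in> X"
    then obtain i y where i: "i \<in> {1..m}" "y \<in> F" "\<pi> x = (S ^^ i) y" using \<pi>(2) F(4) by blast
    \<comment> \<open>\<open>x'\<close> is the point \<open>i\<close> steps before \<open>x\<close>;
      injectivity of \<open>S ^^ i\<close> on \<open>Y\<close> identifies its image with
      \<open>y\<close>, so \<open>x'\<close> lies in \<open>E\<close>.\<close>
    obtain x' where x': "x' \<in> X" "x = (T ^^ i) x'" using T[of i] \<open>x \<in> X\<close> by auto
    then have "\<pi> x' = y"
      using i \<pi>T[of x' i] \<pi>(2) F(2) S[of i] by (auto dest: inj_onD)
    then show "x \<in> (\<Union>i\<in>{1..m}. (T ^^ i) ` E)" using i x' by (intro UN_I[of i] image_eqI[of _ _ x']) (auto simp: E_def)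
  qed
  ultimately show "\<exists>F. openin (top_of_set X) F \<and> marker X T n F"
    unfolding marker_def by (intro exI[of _ E]) (auto simp: E_def)
qed

theorem theorem3p5:
  fixes X :: "'a::metric_space set" and T :: "'a \<Rightarrow> 'a"
    and Y :: "'b::metric_space set" and S :: "'b \<Rightarrow> 'b"
  assumes "tds X T"
    and "tds Y S"
    and "aperiodic Y S"
    and "countable {M. minimal_subsystem Y S M}"
    and "is_extension_of X T Y S"
  shows "marker_property X T"
  using marker_property_extension[OF assms(1,2,5)]
    countably_many_minimal_imp_marker_property[OF assms(2-4)] by simp

end
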